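(* For $m,n\in\mathbb{N}$ with $m+n$ odd, $$(-1)^nR(-m,-n)+(-1)^mR(-n,-m)=\frac{m!\,n!}{(m+n+1)!}.$$
   Context: For $m,n\in\mathbb{N}_0$ with $m+n$ odd, $R(-m,-n):=(-1)^n\frac{m!\,n!}{(m+n+1)!}+\sum_{k=1,\ k\ \text{even}}^{n}\binom{n}{k}\zeta(k-m-n)$, where $\zeta$ is the Riemann zeta function. *)

theory Defs
  imports "HOL-Complex_Analysis.Complex_Analysis"
begin

text \<open>
  The Riemann zeta function: the unique holomorphic continuation of the Dirichlet series
  (absolutely convergent on the half-plane of real part greater than 1) to the complex plane
  minus the point 1. The value 0 at the pole 1 is a dummy value; it only makes the function
  unique as a total function.
\<close>

definition zeta :: "complex \<Rightarrow> complex" where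
  "zeta = (THE f. f holomorphic_on (- {1}) \<and>
                  (\<forall>s. Re s > 1 \<longrightarrow> (\<lambda>j. 1 / of_nat (Suc j) powr s) sums f s) \<and>
                  f 1 = 0)"

text \<open>
  \<open>R_neg m n\<close> is $R(-m,-n)$; it is meaningful for \<open>m + n\<close> odd only. The argument of \<open>zeta\<close> is
  computed in the complex numbers, so there is no truncated subtraction, and since \<open>k \<le> n\<close> and
  \<open>m + n - k\<close> is odd it is always a negative odd integer.
\<close>

definition R_neg :: "nat \<Rightarrow> nat \<Rightarrow> complex" where
  "R_neg m n = (-1) ^ n * (fact m * fact n / fact (m + n + 1)) +
     (\<Sum>k | k \<in> {1..n} \<and> even k.
        of_nat (n choose k) * zeta (of_nat k - of_nat m - of_nat n))"

end

theory Submission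
  imports Defs
begin

text \<open>
  Expanding $(n+1)^{1-s} - n^{1-s}$ binomially around $n$ and summing over $n$ gives, with
  $h(s) = (s-1)\zeta(s)$, the relation
  $\sum_{k<M} \binom{1-s}{k} \frac{h(s+k)}{k+1} = 1 + \sum_n r_M(n,s)$, whose right-hand side is
  holomorphic for $\mathrm{Re}\, s > 1 - M$. It continues $h$ to an entire function, and at
  $s = 1 - j$ the remainders vanish, so that $b_j = h(1-j)$ satisfies the recurrence of the Bernoulli
  numbers $B_j^+$. The theorem becomes the case of odd $m+n$ of the reflection formula
  $(-1)^n T(m,n) + (-1)^m T(n,m) = (-1)^{m+n+1} \frac{m!\,n!}{(m+n+1)!}$ for
  $T(m,n) = \sum_k \binom{n}{k} \frac{B_{m+n-k+1}^-}{m+n-k+1}$. Umbrally $T(m,n)$ is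
  $\int_0^B t^m (1+t)^n\, dt$, hence $T(m,n+1) = T(m,n) + T(m+1,n)$, and the formula follows
  by induction on $n$.
\<close>

section \<open>Locally dominated series of holomorphic functions and the Dirichlet series\<close>

text \<open>Weierstrass test whose majorant may depend on the point: on an open half-plane no single
  majorant serves up to the boundary line.\<close>

lemma holomorphic_on_suminf:
  fixes f :: "nat \<Rightarrow> complex \<Rightarrow> complex"
  assumes "open S" and hol: "\<And>n. f n holomorphic_on S"
    and bound: "\<And>x. x \<in> S \<Longrightarrow> \<exists>d h. 0 < d \<and> summable h \<and> (\<forall>n. \<forall>y\<in>ball x d \<inter> S. norm (f n y) \<le> h n)"
  shows "(\<lambda>x. \<Sum>n. f n x) holomorphic_on S" and "\<And>x. x \<in> S \<Longrightarrow> summable (\<lambda>n. f n x)"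
proof -
  have diff: "f n field_differentiable (at x)" if "x \<in> S" for n x
    using hol[of n] \<open>open S\<close> that by (simp add: holomorphic_on_open field_differentiable_def)
  have bd: "\<exists>d h. 0 < d \<and> summable h \<and> range h \<subseteq> \<real>\<^sub>\<ge>\<^sub>0 \<and>
      (\<forall>\<^sub>F n in sequentially. \<forall>y\<in>ball x d \<inter> S. cmod (f n y) \<le> cmod (h n))" if x: "x \<in> S" for x
  proof -
    obtain d h where d: "0 < d" "summable h" and h: "\<And>n y. y \<in> ball x d \<inter> S \<Longrightarrow> norm (f n y) \<le> h n"
      using bound[OF x] by blast
    have "0 \<le> h n" for n
      using h[of x n] x \<open>0 < d\<close> by (metis IntI centre_in_ball norm_ge_zero order_trans)
    then show ?thesis
      using d h by (intro exI[of _ d] exI[of _ "\<lambda>n. complex_of_real (h n)"])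
        (auto simp: summable_of_real nonneg_Reals_of_real_iff)
  qed
  obtain g where g: "\<forall>x\<in>S. ((\<lambda>n. f n x) sums g x) \<and> g field_differentiable (at x)"
    by (rule series_differentiable_comparison_complex[OF \<open>open S\<close> diff bd]) auto
  show "summable (\<lambda>n. f n x)" if "x \<in> S" for x
    using g that by (auto simp: sums_iff)
  have "g holomorphic_on S"
    using g \<open>open S\<close> by (auto simp: holomorphic_on_def intro: field_differentiable_at_within)
  then show "(\<lambda>x. \<Sum>n. f n x) holomorphic_on S"
    by (rule holomorphic_transform) (use g in \<open>auto simp: sums_iff\<close>)
qed

lemma norm_of_nat_powr: "norm (of_nat (Suc n) powr s :: complex) = real (Suc n) powr Re s"
  by (subst norm_powr_real_powr) auto

lemma summable_Suc_powr: "e < -1 \<Longrightarrow> summable (\<lambda>n. real (Suc n) powr e)"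
  using summable_real_powr_iff[of e] summable_Suc_iff[of "\<lambda>n. real n powr e"] by simp

definition dirichlet_zeta :: "complex \<Rightarrow> complex" where
  "dirichlet_zeta s = (\<Sum>n. of_nat (Suc n) powr (-s))"

lemma open_Re_gt: "open {s. Re s > c}"
  by (simp add: open_halfspace_Re_gt)

lemma connected_Re_gt: "connected {s. Re s > c}"
  by (simp add: convex_connected convex_halfspace_Re_gt)

lemma dirichlet_zeta_holomorphic: "dirichlet_zeta holomorphic_on {s. Re s > 1}"
  and summable_dirichlet_zeta: "Re s > 1 \<Longrightarrow> summable (\<lambda>n. of_nat (Suc n) powr (-s) :: complex)"
proof -
  have bd: "\<exists>d h. 0 < d \<and> summable h \<and> (\<forall>n. \<forall>y\<in>ball x d \<inter> {s. Re s > 1}. norm (of_nat (Suc n) powr (-y) :: complex) \<le> h n)"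
    if x: "x \<in> {s. Re s > 1}" for x
  proof -
    \<comment> \<open>Half the distance to the line Re = 1, so that Re y > 1 + e on the whole
      ball.\<close>
    define e where "e = (Re x - 1) / 2"
    have e: "e > 0" using x by (simp add: e_def)
    have "norm (of_nat (Suc n) powr (-y) :: complex) \<le> real (Suc n) powr (-1 - e)"
      if "y \<in> ball x e" for n y
    proof -
      have "\<bar>Re (x - y)\<bar> < e"
        using that abs_Re_le_cmod[of "x - y"] by (simp add: dist_norm)
      then have "Re (-y) \<le> -1 - e" using abs_ge_self[of "Re (x - y)"] unfolding e_def by (simp add: field_simps)
      then show ?thesis unfolding norm_of_nat_powr by (intro powr_mono) auto
    qed
    then show ?thesis
      using e summable_Suc_powr[of "-1 - e"]
      by (intro exI[of _ e] exI[of _ "\<lambda>n. real (Suc n) powr (-1 - e)"]) auto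
  qed
  have hol: "(\<lambda>s. of_nat (Suc n) powr (-s) :: complex) holomorphic_on {s. Re s > 1}" for n
    by (intro holomorphic_intros)
  show "dirichlet_zeta holomorphic_on {s. Re s > 1}"
    unfolding dirichlet_zeta_def [abs_def] by (rule holomorphic_on_suminf(1)[OF open_Re_gt hol bd])
  show "Re s > 1 \<Longrightarrow> summable (\<lambda>n. of_nat (Suc n) powr (-s) :: complex)"
    using holomorphic_on_suminf(2)[OF open_Re_gt hol bd, of s] by simp
qed

section \<open>Remainders of the binomial expansion\<close>

lemma holomorphic_on_gbinomial [holomorphic_intros]:
  "f holomorphic_on A \<Longrightarrow> (\<lambda>s. f s gchoose k) holomorphic_on A"
  unfolding gbinomial_pochhammer' by (intro holomorphic_intros) auto

text \<open>This is the Taylor remainder of u^(1-s) for a unit step from the base point n + 1; the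
  shift keeps base points positive.\<close>

definition binomial_remainder :: "nat \<Rightarrow> complex \<Rightarrow> nat \<Rightarrow> complex" where
  "binomial_remainder M s n = of_nat (Suc (Suc n)) powr (1 - s) -
     (\<Sum>k\<le>M. ((1 - s) gchoose k) * of_nat (Suc n) powr (1 - s - of_nat k))"

text \<open>Taylor's theorem on the unit segment from n + 1 to n + 2. The derivative of order M + 1
  has modulus proportional to u^(-Re s - M), and the hypothesis makes this exponent nonpositive, so
  the left endpoint gives the maximum.\<close>

lemma norm_binomial_remainder_le:
  assumes "Re s \<ge> - real M"
  shows "norm (binomial_remainder M s n) \<le>
    norm (fact (Suc M) * ((1 - s) gchoose (Suc M))) * real (Suc n) powr (- Re s - real M)"
proof -
  define a where "a = 1 - s"
  \<comment> \<open>\<open>f i\<close> is the i-th derivative of u^a.\<close>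
  define f :: "nat \<Rightarrow> complex \<Rightarrow> complex" where "f = (\<lambda>i u. fact i * (a gchoose i) * u powr (a - of_nat i))"
  define w z :: complex where "w = of_nat (Suc n)" and "z = of_nat (Suc (Suc n))"
  define S where "S = closed_segment w z"
  \<comment> \<open>The segment consists of positive reals, which avoids the branch cut and makes
    the norm of a power explicit.\<close>
  have S: "\<exists>t. t \<ge> real (Suc n) \<and> u = of_real t" if u: "u \<in> S" for u
  proof -
    have "u \<in> of_real ` closed_segment (real (Suc n)) (real (Suc (Suc n)))"
      using u unfolding S_def w_def z_def
      by (metis closed_segment_of_real of_real_of_nat_eq)
    then show ?thesis by (auto simp: closed_segment_eq_real_ivl)
  qed
  have "cmod (f 0 z - (\<Sum>i\<le>M. f i w * (z - w) ^ i / fact i)) \<le>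
      (norm (fact (Suc M) * (a gchoose (Suc M))) * real (Suc n) powr (Re a - real (Suc M))) * cmod (z - w) ^ Suc M / fact M"
  proof (rule complex_Taylor)
    show "convex S" "w \<in> S" "z \<in> S" by (auto simp: S_def)
    show "(f i has_field_derivative f (Suc i) u) (at u within S)" if u: "u \<in> S" for i u
    proof -
      obtain t where t: "t \<ge> real (Suc n)" "u = of_real t" using S[OF u] by blast
      have "u \<notin> \<real>\<^sub>\<le>\<^sub>0" using t by (auto simp: complex_nonpos_Reals_iff)
      then have "(f i has_field_derivative fact i * (a gchoose i) * ((a - of_nat i) * u powr (a - of_nat i - 1))) (at u within S)"
        unfolding f_def by (intro DERIV_cmult has_field_derivative_at_within[OF has_field_derivative_powr])
      moreover have "fact i * (a gchoose i) * ((a - of_nat i) * u powr (a - of_nat i - 1)) = f (Suc i) u"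
        by (simp add: f_def gbinomial_mult_fact algebra_simps)
      ultimately show ?thesis by simp
    qed
    show "cmod (f (Suc M) u) \<le> norm (fact (Suc M) * (a gchoose (Suc M))) * real (Suc n) powr (Re a - real (Suc M))"
      if u: "u \<in> S" for u
    proof -
      obtain t where t: "t \<ge> real (Suc n)" "u = of_real t" using S[OF u] by blast
      have "norm (u powr (a - of_nat (Suc M))) = t powr (Re a - real (Suc M))"
        using t by (subst norm_powr_real_powr) auto
      also have "\<dots> \<le> real (Suc n) powr (Re a - real (Suc M))"
        using t assms by (intro powr_mono2') (auto simp: a_def)
      finally show ?thesis
        unfolding f_def norm_mult by (intro mult_left_mono) auto
    qed
  qed
  moreover have "z - w = 1" by (simp add: z_def w_def)
  moreover have "f 0 z - (\<Sum>i\<le>M. f i w / fact i) = binomial_remainder M s n"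
    by (simp add: f_def binomial_remainder_def w_def z_def a_def)
  ultimately have "norm (binomial_remainder M s n) \<le>
      norm (fact (Suc M) * (a gchoose (Suc M))) * real (Suc n) powr (Re a - real (Suc M)) / fact M"
    by simp
  also have "\<dots> \<le> norm (fact (Suc M) * (a gchoose (Suc M))) * real (Suc n) powr (Re a - real (Suc M)) / 1"
    by (intro divide_left_mono) (auto simp: fact_ge_1)
  finally show ?thesis by (simp add: a_def algebra_simps)
qed

text \<open>In this half-plane the exponent -Re s - M lies below -1, and the coefficient
  \<open>G\<close> is bounded on compact balls, so the terms are locally dominated by a convergent
  p-series.\<close>

lemma sum_binomial_remainder_holomorphic:
  "(\<lambda>s. \<Sum>n. binomial_remainder M s n) holomorphic_on {s. Re s > 1 - real M}"
proof (rule holomorphic_on_suminf(1)[OF open_Re_gt])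
  show "(\<lambda>s. binomial_remainder M s n) holomorphic_on {s. 1 - real M < Re s}" for n
    unfolding binomial_remainder_def by (intro holomorphic_intros)
  fix x assume x: "x \<in> {s. 1 - real M < Re s}"
  define e where "e = (Re x - (1 - real M)) / 2"
  have e: "e > 0" using x by (simp add: e_def)
  define G where "G = (\<lambda>s::complex. norm (fact (Suc M) * ((1 - s) gchoose (Suc M))))"
  have "(\<lambda>s::complex. fact (Suc M) * ((1 - s) gchoose (Suc M))) holomorphic_on cball x e"
    by (intro holomorphic_intros)
  then have "continuous_on (cball x e) G"
    unfolding G_def by (intro continuous_on_norm holomorphic_on_imp_continuous_on)
  then have "compact (G ` cball x e)" by (intro compact_continuous_image) auto
  then obtain B where B: "\<And>y. y \<in> cball x e \<Longrightarrow> G y \<le> B"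
    using bounded_has_Sup(1)[OF compact_imp_bounded] e
    by (metis centre_in_cball image_eqI less_eq_real_def equals0D)
  have "norm (binomial_remainder M y n) \<le> B * real (Suc n) powr (-1 - e)"
    if y: "y \<in> ball x e" for y n
  proof -
    have "\<bar>Re (x - y)\<bar> < e"
      using y abs_Re_le_cmod[of "x - y"] by (simp add: dist_norm)
    then have *: "Re y + real M \<ge> 1 + e" using abs_ge_self[of "Re (x - y)"] unfolding e_def by (simp add: field_simps)
    have "norm (binomial_remainder M y n) \<le> G y * real (Suc n) powr (- Re y - real M)"
      unfolding G_def by (rule norm_binomial_remainder_le) (use * e in linarith)
    also have "\<dots> \<le> B * real (Suc n) powr (-1 - e)"
    proof (intro mult_mono powr_mono)
      show "G y \<le> B" using B y by (auto simp: less_imp_le)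
      then show "0 \<le> B" by (rule order_trans[rotated]) (simp add: G_def)
    qed (use * in auto)
    finally show ?thesis .
  qed
  then have "\<forall>n. \<forall>y\<in>ball x e \<inter> {s. 1 - real M < Re s}. norm (binomial_remainder M y n) \<le> B * real (Suc n) powr (-1 - e)"
    by blast
  moreover have "summable (\<lambda>n. B * real (Suc n) powr (-1 - e))"
    using e by (intro summable_mult summable_Suc_powr) simp
  ultimately show "\<exists>d h. 0 < d \<and> summable h \<and>
     (\<forall>n. \<forall>y\<in>ball x d \<inter> {s. 1 - real M < Re s}. cmod (binomial_remainder M y n) \<le> h n)"
    using e by (intro exI[of _ e] exI[of _ "\<lambda>n. B * real (Suc n) powr (-1 - e)"] conjI)
qed

section \<open>Continuation of (s-1) zeta(s) to an entire function\<close>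

text \<open>Used to extract the factor s + k - 1, which cancels the pole of zeta(s+k).\<close>

lemma gbinomial_Suc_minus:
  fixes s :: complex
  shows "((1 - s) gchoose (Suc k)) = - (((1 - s) gchoose k) * (s + of_nat k - 1) / of_nat (Suc k))"
proof -
  have "of_nat (Suc k) * ((1 - s) gchoose (Suc k)) = - (((1 - s) gchoose k) * (s + of_nat k - 1))"
    using gbinomial_mult_1[of "1 - s" k] by (simp add: algebra_simps)
  then show ?thesis
    using nonzero_mult_div_cancel_left[OF of_nat_neq_0[of k, where 'a = complex], of "(1 - s) gchoose (Suc k)"]
    by (simp only: minus_divide_left)
qed

lemma dirichlet_zeta_recurrence:
  assumes s: "Re s > 1"
  shows "(\<Sum>k<M. ((1 - s) gchoose k) / of_nat (Suc k) * ((s + of_nat k - 1) * dirichlet_zeta (s + of_nat k)))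
    = 1 + (\<Sum>n. binomial_remainder M s n)"
proof -
  define a where "a = 1 - s"
  have "(\<lambda>n. of_nat (Suc n) powr a) \<longlonglongrightarrow> (0::complex)"
    by (rule tendsto_neg_powr_complex_of_nat) (use s in \<open>auto simp: a_def filterlim_Suc\<close>)
  from telescope_sums[OF this]
  \<comment> \<open>The powers tend to 0 because Re a < 0, and the first one is 1.\<close>
  have 1: "(\<lambda>n. of_nat (Suc (Suc n)) powr a - of_nat (Suc n) powr a) sums (- 1 :: complex)" by simp
  have 2: "(\<lambda>n. of_nat (Suc n) powr (a - of_nat (Suc k))) sums dirichlet_zeta (s + of_nat k)" for k
  proof -
    have "(\<lambda>n. of_nat (Suc n) powr (-(s + of_nat k)) :: complex) sums dirichlet_zeta (s + of_nat k)"
      unfolding dirichlet_zeta_def by (intro summable_sums summable_dirichlet_zeta) (use s in auto)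
    then show ?thesis by (simp add: a_def algebra_simps)
  qed
  have "(\<lambda>n. (of_nat (Suc (Suc n)) powr a - of_nat (Suc n) powr a) -
      (\<Sum>k<M. (a gchoose Suc k) * of_nat (Suc n) powr (a - of_nat (Suc k)))) sums
      (- 1 - (\<Sum>k<M. (a gchoose Suc k) * dirichlet_zeta (s + of_nat k)))"
    by (intro sums_diff sums_sum sums_mult 1 2)
  also have "(\<lambda>n. (of_nat (Suc (Suc n)) powr a - of_nat (Suc n) powr a) -
      (\<Sum>k<M. (a gchoose Suc k) * of_nat (Suc n) powr (a - of_nat (Suc k)))) = binomial_remainder M s"
    \<comment> \<open>The \<open>k = 0\<close> term of the expansion is the power subtracted in the
      telescoping difference.\<close>
    by (rule ext) (simp add: binomial_remainder_def a_def sum.atMost_shift del: of_nat_Suc)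
  finally have "(\<Sum>n. binomial_remainder M s n) = - 1 - (\<Sum>k<M. (a gchoose Suc k) * dirichlet_zeta (s + of_nat k))"
    by (simp add: sums_iff)
  then show ?thesis
    by (simp add: a_def gbinomial_Suc_minus sum_negf mult_ac del: of_nat_Suc)
qed

text \<open>Each step gains a strip of width 1: the relation for \<open>M = Suc j\<close> contains
  h(s) with coefficient 1, and its other terms h(s+1), ..., h(s+j) are already available for Re s >
  -j.\<close>

lemma dirichlet_zeta_extends:
  "\<exists>h. h holomorphic_on {s. Re s > 1 - real j} \<and> (\<forall>s. Re s > 1 \<longrightarrow> h s = (s - 1) * dirichlet_zeta s)"
proof (induction j)
  case 0
  show ?case
    by (intro exI[of _ "\<lambda>s. (s - 1) * dirichlet_zeta s"])
      (auto intro!: holomorphic_intros dirichlet_zeta_holomorphic)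
next
  case (Suc j)
  then obtain h where h: "h holomorphic_on {s. Re s > 1 - real j}"
    and hz: "\<And>s. Re s > 1 \<Longrightarrow> h s = (s - 1) * dirichlet_zeta s" by blast
  \<comment> \<open>The relation solved for its \<open>k = 0\<close> term.\<close>
  define g where "g = (\<lambda>s. 1 + (\<Sum>n. binomial_remainder (Suc j) s n) -
     (\<Sum>k<j. ((1 - s) gchoose Suc k) / of_nat (Suc (Suc k)) * h (s + of_nat (Suc k))))"
  have "(\<lambda>s. h (s + of_nat (Suc k))) holomorphic_on {s. Re s > 1 - real (Suc j)}" for k
  proof -
    have "h \<circ> (\<lambda>s. s + of_nat (Suc k)) holomorphic_on {s. Re s > 1 - real (Suc j)}"
      by (rule holomorphic_on_compose_gen[OF _ h]) (auto intro!: holomorphic_intros)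
    then show ?thesis by (simp add: o_def)
  qed
  then have "g holomorphic_on {s. Re s > 1 - real (Suc j)}"
    unfolding g_def by (intro holomorphic_intros sum_binomial_remainder_holomorphic) auto
  moreover have "g s = (s - 1) * dirichlet_zeta s" if "Re s > 1" for s
  proof -
    have "(s - 1) * dirichlet_zeta s + (\<Sum>k<j. ((1 - s) gchoose Suc k) / of_nat (Suc (Suc k)) *
        ((s + of_nat (Suc k) - 1) * dirichlet_zeta (s + of_nat (Suc k)))) = 1 + (\<Sum>n. binomial_remainder (Suc j) s n)"
      using dirichlet_zeta_recurrence[OF that, of "Suc j"]
      by (simp add: sum.lessThan_Suc_shift of_nat_Suc[of 0] del: sum.lessThan_Suc of_nat_Suc)
    moreover have "h (s + of_nat (Suc k)) = (s + of_nat (Suc k) - 1) * dirichlet_zeta (s + of_nat (Suc k))" for k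
      by (rule hz) (use that in simp)
    ultimately show ?thesis unfolding g_def by (simp only: diff_eq_eq)
  qed
  ultimately show ?case by blast
qed

text \<open>Extensions to different half-planes agree by the identity theorem, so they glue.\<close>

lemma dirichlet_zeta_entire_extension:
  "\<exists>h. h holomorphic_on UNIV \<and> (\<forall>s. Re s > 1 \<longrightarrow> h s = (s - 1) * dirichlet_zeta s)"
proof -
  obtain H where H: "\<And>j. H j holomorphic_on {s. Re s > 1 - real j}"
    and Hz: "\<And>j s. Re s > 1 \<Longrightarrow> H j s = (s - 1) * dirichlet_zeta s"
    using dirichlet_zeta_extends by metis
  have eq: "H i s = H j s" if "i \<le> j" "Re s > 1 - real i" for i j s
  proof (rule analytic_continuation_open[OF open_Re_gt[of 1] open_Re_gt[of "1 - real i"] _ connected_Re_gt,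
        where f = "H i" and g = "H j"])
    show "{s::complex. Re s > 1} \<noteq> {}" by (auto intro: exI[of _ 2])
    show "H j holomorphic_on {s. Re s > 1 - real i}"
      by (rule holomorphic_on_subset[OF H]) (use that in auto)
  qed (use that H Hz in auto)
  \<comment> \<open>This index is at least 2 - Re s, so s lies inside the corresponding half-plane
    with room to spare.\<close>
  define h where "h = (\<lambda>s. H (nat \<lceil>2 - Re s\<rceil>) s)"
  have h: "h s = H j s" if "Re s > 1 - real j" for s j
  proof -
    have "Re s > 1 - real (nat \<lceil>2 - Re s\<rceil>)" by linarith
    then show ?thesis
      using eq[of j "nat \<lceil>2 - Re s\<rceil>" s] eq[of "nat \<lceil>2 - Re s\<rceil>" j s] that
      unfolding h_def by (cases "j \<le> nat \<lceil>2 - Re s\<rceil>") auto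
  qed
  have "h holomorphic_on {s. Re s > 1 - real j}" for j
    by (rule holomorphic_transform[OF H]) (simp add: h)
  moreover have "\<exists>j. s \<in> {s. Re s > 1 - real j}" for s
    by (intro exI[of _ "nat \<lceil>2 - Re s\<rceil>"]) (simp, linarith)
  ultimately have "h field_differentiable (at s)" for s
    using holomorphic_on_imp_differentiable_at[OF _ open_Re_gt] by blast
  then have "h holomorphic_on UNIV" by (simp add: holomorphic_on_def)
  moreover have "h s = (s - 1) * dirichlet_zeta s" if "Re s > 1" for s
    using h[of 0 s] Hz[of s 0] that by simp
  ultimately show ?thesis by (intro exI[of _ h] conjI allI impI)
qed

section \<open>The recurrence at s = 1 - j\<close>

text \<open>Both sides are holomorphic on the larger, connected half-plane and agree for Re s >
  1.\<close>

lemma entire_extension_recurrence: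
  assumes h: "h holomorphic_on UNIV" and hz: "\<And>s. Re s > 1 \<Longrightarrow> h s = (s - 1) * dirichlet_zeta s"
    and s: "Re s > 1 - real M"
  shows "(\<Sum>k<M. ((1 - s) gchoose k) / of_nat (Suc k) * h (s + of_nat k)) = 1 + (\<Sum>n. binomial_remainder M s n)"
proof (rule analytic_continuation_open[OF open_Re_gt[of 1] open_Re_gt[of "1 - real M"] _ connected_Re_gt,
      where f = "\<lambda>s. \<Sum>k<M. ((1 - s) gchoose k) / of_nat (Suc k) * h (s + of_nat k)"])
  show "{s::complex. Re s > 1} \<noteq> {}" by (auto intro: exI[of _ 2])
  have "(\<lambda>s. h (s + of_nat k)) holomorphic_on {s. Re s > 1 - real M}" for k
  proof -
    have "h \<circ> (\<lambda>s. s + of_nat k) holomorphic_on {s. Re s > 1 - real M}"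
      by (rule holomorphic_on_compose_gen[OF _ h]) (auto intro!: holomorphic_intros)
    then show ?thesis by (simp add: o_def)
  qed
  then show "(\<lambda>s. \<Sum>k<M. ((1 - s) gchoose k) / of_nat (Suc k) * h (s + of_nat k)) holomorphic_on {s. Re s > 1 - real M}"
    by (intro holomorphic_intros) auto
  show "(\<lambda>s. 1 + (\<Sum>n. binomial_remainder M s n)) holomorphic_on {s. Re s > 1 - real M}"
    by (intro holomorphic_intros sum_binomial_remainder_holomorphic)
  show "(\<Sum>k<M. ((1 - s) gchoose k) / of_nat (Suc k) * h (s + of_nat k)) = 1 + (\<Sum>n. binomial_remainder M s n)"
    if "s \<in> {s. Re s > 1}" for s
  proof -
    have "h (s + of_nat k) = (s + of_nat k - 1) * dirichlet_zeta (s + of_nat k)" for k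
      by (rule hz) (use that in simp)
    then show ?thesis using dirichlet_zeta_recurrence[of s M] that by simp
  qed
qed (use s in auto)

text \<open>Here the exponent 1 - s is the natural number j, so the expansion is the finite binomial
  theorem and is exact once M reaches j.\<close>

lemma binomial_remainder_nonpos_int:
  assumes "j \<le> M"
  shows "binomial_remainder M (1 - of_nat j) n = 0"
proof -
  have pw: "(of_nat (Suc m) :: complex) powr (of_nat j - of_nat k) = of_nat (Suc m) ^ (j - k)" if "k \<le> j" for m k
    using powr_complexpow[OF of_nat_neq_0[of m, where 'a = complex], of "j - k"] that by (simp only: of_nat_diff)
  have "(\<Sum>k\<le>M. ((of_nat j :: complex) gchoose k) * of_nat (Suc n) powr (of_nat j - of_nat k)) =
      (\<Sum>k\<le>j. ((of_nat j :: complex) gchoose k) * of_nat (Suc n) powr (of_nat j - of_nat k))"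
    by (rule sum.mono_neutral_right) (use assms in \<open>auto simp flip: binomial_gbinomial\<close>)
  also have "\<dots> = (\<Sum>k\<le>j. of_nat (j choose k) * 1 ^ k * of_nat (Suc n) ^ (j - k))"
    by (rule sum.cong) (auto simp: pw binomial_gbinomial simp del: of_nat_Suc)
  also have "\<dots> = (1 + of_nat (Suc n)) ^ j" by (rule binomial_ring[symmetric])
  finally show ?thesis
    using pw[of 0 "Suc n"] by (simp add: binomial_remainder_def)
qed

lemma entire_extension_nonpos_recurrence:
  assumes h: "h holomorphic_on UNIV" and hz: "\<And>s. Re s > 1 \<Longrightarrow> h s = (s - 1) * dirichlet_zeta s"
  shows "(\<Sum>k\<le>j. of_nat (j choose k) / of_nat (Suc k) * h (1 - of_nat (j - k))) = 1"
proof -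
  have "(\<Sum>k\<le>j. of_nat (j choose k) / of_nat (Suc k) * h (1 - of_nat (j - k))) =
    (\<Sum>k<Suc j. (of_nat j gchoose k) / of_nat (Suc k) * h (1 - of_nat j + of_nat k))"
    unfolding lessThan_Suc_atMost by (intro sum.cong) (auto simp: binomial_gbinomial of_nat_diff algebra_simps)
  also have "\<dots> = 1"
    \<comment> \<open>\<open>M = Suc j\<close> puts the point 1 - j inside the half-plane Re s > 1 -
      M.\<close>
    using entire_extension_recurrence[OF h hz, where s = "1 - of_nat j" and M = "Suc j"]
    by (simp add: binomial_remainder_nonpos_int)
  finally show ?thesis .
qed

section \<open>Bernoulli numbers and the umbral Beta integral\<close>

text \<open>The \<open>k = 0\<close> term expresses \<open>b j\<close> by earlier values, so the
  recurrence has a single solution: the Bernoulli numbers with b_1 = 1/2.\<close>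

locale bernoulli_recurrence =
  fixes b :: "nat \<Rightarrow> 'a :: field_char_0"
  assumes rec: "\<And>j. (\<Sum>k\<le>j. of_nat (j choose k) / of_nat (Suc k) * b (j - k)) = 1"
begin

text \<open>With D = (e^x - 1)/x the recurrence reads D B = e^x. Since D(-x) = e^(-x) D(x),
  substituting -x gives D C = 1. Both claims follow by cancelling D.\<close>

lemma bernoulli_egf:
  defines "B \<equiv> Abs_fps (\<lambda>j. b j / fact j)" and "C \<equiv> Abs_fps (\<lambda>j. (-1) ^ j * b j / fact j)"
  shows "C * fps_exp 1 = B" and "B = C + fps_X"
proof -
  define D :: "'a fps" where "D = Abs_fps (\<lambda>i. 1 / fact (Suc i))"
  define E :: "'a fps" where "E = fps_exp 1"
  define E' :: "'a fps" where "E' = fps_exp (-1)"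
  have EE': "E' * E = 1"
    unfolding E_def E'_def by (subst fps_exp_add_mult[symmetric]) simp
  have DB: "D * B = E"
  proof (rule fps_ext)
    fix j
    have "fps_nth (D * B) j = (\<Sum>i\<le>j. of_nat (j choose i) / of_nat (Suc i) * b (j - i)) / fact j"
      unfolding fps_mult_nth D_def B_def sum_divide_distrib atLeast0AtMost
      by (rule sum.cong) (auto simp: binomial_fact divide_simps simp del: of_nat_Suc)
    then show "fps_nth (D * B) j = fps_nth E j" unfolding rec by (simp add: E_def)
  qed
  have XD: "fps_X * D = E - 1"
    by (rule fps_ext) (auto simp: D_def E_def gr0_conv_Suc)
  have BC: "B oo - fps_X = C"
    by (rule fps_ext) (simp add: B_def C_def fps_compose_uminus')
  have E'E: "E oo - fps_X = E'"
    by (rule fps_ext) (simp add: E_def E'_def fps_compose_uminus')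
  \<comment> \<open>Computes D(-x) after multiplication by -x, which is then cancelled.\<close>
  have "- fps_X * (D oo - fps_X) = E' - 1"
    using arg_cong[OF XD, of "\<lambda>F. F oo - fps_X"]
    by (simp add: fps_compose_mult_distrib fps_compose_sub_distrib E'E fps_X_fps_compose_startby0)
  also have "\<dots> = E' * (1 - E)" by (simp add: right_diff_distrib EE')
  also have "\<dots> = - fps_X * (E' * D)"
    by (simp add: XD[symmetric] mult.left_commute minus_diff_eq[of E 1, symmetric] del: minus_diff_eq)
  finally have "D oo - fps_X = E' * D" by simp
  then have "E' * (D * C) = E'"
    using arg_cong[OF DB, of "\<lambda>F. F oo - fps_X"]
    by (simp add: fps_compose_mult_distrib BC E'E mult.assoc)
  moreover have "E' \<noteq> 0" and "D \<noteq> 0" using EE' DB by auto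
  ultimately have DC: "D * C = 1" by simp
  then have "D * (E * C) = D * B" unfolding DB by (simp add: mult.left_commute)
  then show "C * fps_exp 1 = B" using \<open>D \<noteq> 0\<close> by (simp add: E_def mult.commute)
  have "D * B = D * (C + fps_X)" using XD by (simp add: DB DC distrib_left mult.commute[of D fps_X])
  then show "B = C + fps_X" using \<open>D \<noteq> 0\<close> by simp
qed

lemma bernoulli_odd_eq_0:
  assumes "odd j" "j \<noteq> 1"
  shows "b j = 0"
proof -
  \<comment> \<open>Coefficient of x^j in B = C + x.\<close>
  have "b j / fact j = - (b j / fact j)"
    using arg_cong[OF bernoulli_egf(2), of "\<lambda>F. fps_nth F j"] assms by simp
  then show ?thesis by (simp add: eq_neg_iff_add_eq_0 flip: mult_2)
qed

text \<open>Coefficients of C e^x = B; umbrally, (1 + B^-)^j = B_j^+.\<close>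

lemma bernoulli_binomial_sum: "(\<Sum>k\<le>j. of_nat (j choose k) * ((-1) ^ k * b k)) = b j"
proof -
  have "(\<Sum>k\<le>j. of_nat (j choose k) * ((-1) ^ k * b k)) / fact j = b j / fact j"
    using arg_cong[OF bernoulli_egf(1), of "\<lambda>F. fps_nth F j"]
    by (simp add: sum_divide_distrib fps_mult_nth atLeast0AtMost binomial_fact)
  then show ?thesis by simp
qed

text \<open>With $b_j = B_j^+$, this is $B_j^-$, which differs only at $j = 1$.\<close>

abbreviation b_minus :: "nat \<Rightarrow> 'a" where "b_minus j \<equiv> (-1) ^ j * b j"

text \<open>The powers of t are taken from the highest down, so that \<open>k\<close> matches the
  index in \<open>R_neg\<close>.\<close>

definition bernoulli_beta :: "nat \<Rightarrow> nat \<Rightarrow> 'a" where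
  "bernoulli_beta m n = (\<Sum>k\<le>n. of_nat (n choose k) * (b_minus (m + n - k + 1) / of_nat (m + n - k + 1)))"

text \<open>Umbrally t^m (1+t)^(n+1) = t^m (1+t)^n + t^(m+1) (1+t)^n; on coefficients this is
  Pascal's rule.\<close>

lemma bernoulli_beta_Suc: "bernoulli_beta m (Suc n) = bernoulli_beta m n + bernoulli_beta (Suc m) n"
proof -
  define d where "d j = b_minus (j + 1) / of_nat (j + 1)" for j
  have T: "bernoulli_beta m n = (\<Sum>k\<le>n. of_nat (n choose k) * d (m + k))" for m n
    unfolding bernoulli_beta_def d_def
    by (rule sum.reindex_bij_witness[of _ "\<lambda>k. n - k" "\<lambda>k. n - k"]) (auto simp flip: binomial_symmetric)
  have "bernoulli_beta m (Suc n) = d m + (\<Sum>k\<le>n. of_nat (Suc n choose Suc k) * d (Suc m + k))"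
    unfolding T by (subst sum.atMost_Suc_shift) simp
  also have "\<dots> = d m + (\<Sum>k\<le>n. of_nat (n choose Suc k) * d (Suc m + k)) + (\<Sum>k\<le>n. of_nat (n choose k) * d (Suc m + k))"
    by (simp add: sum.distrib distrib_right)
  also have "d m + (\<Sum>k\<le>n. of_nat (n choose Suc k) * d (Suc m + k)) = (\<Sum>k\<le>Suc n. of_nat (n choose k) * d (m + k))"
    by (subst sum.atMost_Suc_shift) simp
  also have "\<dots> = (\<Sum>k\<le>n. of_nat (n choose k) * d (m + k))" by simp
  finally show ?thesis unfolding T by simp
qed

lemma bernoulli_beta_0_right: "bernoulli_beta m 0 = b_minus (m + 1) / of_nat (m + 1)"
  by (simp add: bernoulli_beta_def)

text \<open>Umbrally the integral of (1+t)^m from 0 to B^- is ((1+B^-)^(m+1) - 1)/(m+1), and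
  (1+B^-)^(m+1) evaluates to \<open>b (Suc m)\<close>.\<close>

lemma bernoulli_beta_0_left: "of_nat (Suc m) * bernoulli_beta 0 m = b (Suc m) - 1"
proof -
  have b0: "b 0 = 1" using rec[of 0] by simp
  have "of_nat (Suc m) * bernoulli_beta 0 m =
      (\<Sum>k\<le>m. of_nat (Suc m) * (of_nat (m choose k) * (b_minus (Suc k) / of_nat (Suc k))))"
    unfolding bernoulli_beta_def sum_distrib_left
    by (rule sum.reindex_bij_witness[of _ "\<lambda>k. m - k" "\<lambda>k. m - k"]) (auto simp flip: binomial_symmetric)
  also have "\<dots> = (\<Sum>k\<le>m. of_nat (Suc m choose Suc k) * b_minus (Suc k))"
  proof (rule sum.cong)
    fix k assume "k \<in> {..m}"
    have "of_nat (Suc k) * of_nat (Suc m choose Suc k) = (of_nat (Suc m) * of_nat (m choose k) :: 'a)"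
      using Suc_times_binomial_eq[of m k] by (metis mult.commute of_nat_mult)
    then show "of_nat (Suc m) * (of_nat (m choose k) * (b_minus (Suc k) / of_nat (Suc k))) = of_nat (Suc m choose Suc k) * b_minus (Suc k)"
      by (simp add: field_simps del: of_nat_Suc binomial_Suc_Suc)
  qed simp
  also have "\<dots> = (\<Sum>k\<le>Suc m. of_nat (Suc m choose k) * b_minus k) - 1"
    by (simp add: sum.atMost_Suc_shift b0 del: sum.atMost_Suc binomial_Suc_Suc)
  finally show ?thesis by (simp only: bernoulli_binomial_sum)
qed

text \<open>Umbrally, substitute t -> -1-t: since -1-B^- has the same moments as B^-, the two
  integrals combine to one over [-1,0], a Beta integral up to sign. The induction below makes this
  rigorous.\<close>

lemma bernoulli_beta_reflection:
  "(-1) ^ n * bernoulli_beta m n + (-1) ^ m * bernoulli_beta n m =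
     (-1) ^ (m + n + 1) * (fact m * fact n / fact (m + n + 1))"
proof (induction n arbitrary: m)
  case 0
  have "of_nat (Suc m) * (bernoulli_beta m 0 + (-1) ^ m * bernoulli_beta 0 m) =
      b_minus (Suc m) + (-1) ^ m * (of_nat (Suc m) * bernoulli_beta 0 m)"
    by (simp only: bernoulli_beta_0_right distrib_left mult.left_commute[of _ "(-1) ^ m"]) (simp del: of_nat_Suc)
  \<comment> \<open>The two multiples of \<open>b (Suc m)\<close> have opposite signs and cancel;
    only the -1 from \<open>bernoulli_beta_0_left\<close> survives.\<close>
  also have "\<dots> = - ((-1) ^ m)"
    unfolding bernoulli_beta_0_left by (simp add: algebra_simps)
  finally have "bernoulli_beta m 0 + (-1) ^ m * bernoulli_beta 0 m = - ((-1) ^ m) / of_nat (Suc m)"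
    by (metis nonzero_mult_div_cancel_left of_nat_neq_0)
  then show ?case by simp
next
  case (Suc n)
  define \<beta> :: "nat \<Rightarrow> nat \<Rightarrow> 'a" where "\<beta> = (\<lambda>m n. fact m * fact n / fact (m + n + 1))"
  \<comment> \<open>The same recurrence for the integral of x^m (1-x)^n over [0,1], obtained by
    splitting off one factor 1 - x.\<close>
  have beta: "\<beta> m (Suc n) = \<beta> m n - \<beta> (Suc m) n"
  proof -
    define r :: 'a where "r = of_nat (m + n + 2)"
    have "r \<noteq> 0" unfolding r_def by (simp only: of_nat_eq_0_iff)
    have "\<beta> m (Suc n) = of_nat (Suc n) * (fact m * fact n) / (r * fact (m + n + 1))"
      and "\<beta> (Suc m) n = of_nat (Suc m) * (fact m * fact n) / (r * fact (m + n + 1))"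
      by (simp_all add: \<beta>_def r_def algebra_simps)
    moreover have "\<beta> m n = r * (fact m * fact n) / (r * fact (m + n + 1))"
      using \<open>r \<noteq> 0\<close> by (simp add: \<beta>_def)
    moreover have "of_nat (Suc n) = r - of_nat (Suc m)" by (simp add: r_def)
    ultimately show ?thesis by (simp only: left_diff_distrib diff_divide_distrib)
  qed
  \<comment> \<open>The term \<open>bernoulli_beta (Suc n) m\<close> is the difference of
    \<open>bernoulli_beta n (Suc m)\<close> and \<open>bernoulli_beta n m\<close>, so the induction
    hypothesis is used at both \<open>m\<close> and \<open>Suc m\<close>.\<close>
  have "(-1) ^ Suc n * bernoulli_beta m (Suc n) + (-1) ^ m * bernoulli_beta (Suc n) m =
     - ((-1) ^ n * bernoulli_beta m n + (-1) ^ m * bernoulli_beta n m)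
     - ((-1) ^ n * bernoulli_beta (Suc m) n + (-1) ^ Suc m * bernoulli_beta n (Suc m))"
    by (simp add: bernoulli_beta_Suc algebra_simps)
  also have "\<dots> = (-1) ^ (m + Suc n + 1) * \<beta> m (Suc n)"
    unfolding Suc.IH beta unfolding \<beta>_def by (simp add: algebra_simps)
  finally show ?case by (simp only: \<beta>_def)
qed

end

section \<open>Identification of zeta and its values at nonpositive integers\<close>

lemma zeta_entire_extension:
  obtains h where "h holomorphic_on UNIV"
    and "\<And>s. Re s > 1 \<Longrightarrow> h s = (s - 1) * dirichlet_zeta s"
    and "\<And>s. zeta s = h s / (s - 1)"
proof -
  obtain h where h: "h holomorphic_on UNIV"
    and hz: "\<And>s. Re s > 1 \<Longrightarrow> h s = (s - 1) * dirichlet_zeta s"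
    using dirichlet_zeta_entire_extension by blast
  define g where "g = (\<lambda>s. h s / (s - 1))"
  have series: "(\<lambda>j. 1 / of_nat (Suc j) powr s) sums dirichlet_zeta s" if "Re s > 1" for s
    using summable_sums[OF summable_dirichlet_zeta[OF that]]
    by (simp add: dirichlet_zeta_def powr_minus_divide)
  have hol: "g holomorphic_on (- {1})"
    unfolding g_def by (intro holomorphic_intros holomorphic_on_subset[OF h]) auto
  have "zeta = g"
    unfolding zeta_def
  proof (rule the_equality)
    have "g s = dirichlet_zeta s" if "Re s > 1" for s
      using that by (auto simp: g_def hz)
    \<comment> \<open>Division by zero makes \<open>g 1 = 0\<close>, in agreement with the dummy
      value of \<open>zeta\<close>.\<close>
    then show "g holomorphic_on - {1} \<and> (\<forall>s. 1 < Re s \<longrightarrow> (\<lambda>j. 1 / of_nat (Suc j) powr s) sums g s) \<and> g 1 = 0"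
      using hol series by (simp add: g_def)
  next
    fix f assume f: "f holomorphic_on - {1} \<and> (\<forall>s. 1 < Re s \<longrightarrow> (\<lambda>j. 1 / of_nat (Suc j) powr s) sums f s) \<and> f 1 = 0"
    show "f = g"
    proof
      fix s
      show "f s = g s"
      proof (cases "s = 1")
        case True
        then show ?thesis using f by (simp add: g_def)
      next
        case False
        show ?thesis
        \<comment> \<open>Uniqueness: the punctured plane is connected, and both functions are the
          Dirichlet series for Re s > 1.\<close>
        proof (rule analytic_continuation_open[OF open_Re_gt[of 1], where s' = "- {1}" and f = f and g = g])
          show "{s::complex. Re s > 1} \<noteq> {}" by (auto intro: exI[of _ 2])
          show "connected (- {1::complex})" by (rule connected_punctured_universe) simp
          show "f z = g z" if "z \<in> {s. Re s > 1}" for z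
          proof -
            have "f z = dirichlet_zeta z"
              using f series[of z] that by (auto intro: sums_unique2)
            also have "\<dots> = g z" using that by (auto simp: g_def hz)
            finally show ?thesis .
          qed
        qed (use f hol False in auto)
      qed
    qed
  qed
  then have "zeta s = h s / (s - 1)" for s by (metis g_def)
  with h hz show ?thesis by (rule that)
qed

text \<open>At s = -N the denominator s - 1 is -(N+1), and -N = 1 - (N+1) turns h(s) into
  \<open>b (Suc N)\<close>. The sign convention b_1 = 1/2 also covers N = 0.\<close>

lemma zeta_nonpos_int:
  obtains b where "bernoulli_recurrence b" and "\<And>N. zeta (- of_nat N) = - b (Suc N) / of_nat (Suc N)"
proof -
  obtain h where h: "h holomorphic_on UNIV"
    and hz: "\<And>s. Re s > 1 \<Longrightarrow> h s = (s - 1) * dirichlet_zeta s"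
    and zeta: "\<And>s. zeta s = h s / (s - 1)"
    using zeta_entire_extension by blast
  show thesis
  proof
    show "bernoulli_recurrence (\<lambda>j. h (1 - of_nat j))"
      using entire_extension_nonpos_recurrence[OF h hz] by unfold_locales
    have "- of_nat N - 1 = - (of_nat (Suc N) :: complex)" "- of_nat N = 1 - (of_nat (Suc N) :: complex)" for N
      by simp_all
    then show "zeta (- of_nat N) = - h (1 - of_nat (Suc N)) / of_nat (Suc N)" for N
      unfolding zeta by (metis minus_divide_left minus_divide_right)
  qed
qed

section \<open>R(-m,-n) in terms of the umbral Beta integral\<close>

lemma R_neg_bernoulli_beta:
  assumes "bernoulli_recurrence b" and zeta: "\<And>N. zeta (- of_nat N) = - b (Suc N) / of_nat (Suc N)"
    and "m \<ge> 1" "odd (m + n)"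
  shows "R_neg m n = (-1) ^ n * (fact m * fact n / fact (m + n + 1)) + b (m + n + 1) / of_nat (m + n + 1)
    - bernoulli_recurrence.bernoulli_beta b m n"
proof -
  interpret bernoulli_recurrence b by fact
  define t where "t k = of_nat (n choose k) * ((-1) ^ (m + n - k + 1) * b (m + n - k + 1) / of_nat (m + n - k + 1))" for k
  have "(\<Sum>k | k \<in> {1..n} \<and> even k. of_nat (n choose k) * zeta (of_nat k - of_nat m - of_nat n)) =
      (\<Sum>k | k \<in> {1..n} \<and> even k. - t k)"
  proof (rule sum.cong)
    fix k assume k: "k \<in> {k. k \<in> {1..n} \<and> even k}"
    have *: "of_nat k - of_nat m - of_nat n = - (of_nat (m + n - k) :: complex)"
      using k by (simp add: of_nat_diff)
    have "even (m + n - k + 1)" using k assms(4) by auto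
    then show "of_nat (n choose k) * zeta (of_nat k - of_nat m - of_nat n) = - t k"
      unfolding * zeta t_def by (simp del: of_nat_Suc)
  qed simp
  \<comment> \<open>Odd \<open>k\<close> may be added: then m + n - k + 1 is odd and, because m >=
    1, at least 2, so its Bernoulli number vanishes.\<close>
  also have "\<dots> = (\<Sum>k\<in>{1..n}. - t k)"
  proof (rule sum.mono_neutral_left)
    show "\<forall>k\<in>{1..n} - {k. k \<in> {1..n} \<and> even k}. - t k = 0"
    proof
      fix k assume k: "k \<in> {1..n} - {k. k \<in> {1..n} \<and> even k}"
      have "odd (m + n - k + 1)" "m + n - k + 1 \<noteq> 1" using k assms(3,4) by auto
      then have "b (m + n - k + 1) = 0" by (rule bernoulli_odd_eq_0)
      then show "- t k = 0" by (simp add: t_def)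
    qed
  qed auto
  \<comment> \<open>The sum in \<open>R_neg\<close> starts at 1, so the \<open>k = 0\<close> term
    must be compensated.\<close>
  also have "\<dots> = t 0 - (\<Sum>k\<le>n. t k)"
    by (simp add: sum_negf sum.atMost_shift sum.atLeast1_atMost_eq lessThan_Suc_atMost)
  also have "(\<Sum>k\<le>n. t k) = bernoulli_beta m n" by (simp only: t_def bernoulli_beta_def)
  also have "t 0 = b (m + n + 1) / of_nat (m + n + 1)" using assms(4) by (simp add: t_def)
  finally show ?thesis by (simp add: R_neg_def)
qed

theorem theorem4p3:
  fixes m n :: nat
  assumes "m \<ge> 1" and "n \<ge> 1" and "odd (m + n)"
  shows "(-1) ^ n * R_neg m n + (-1) ^ m * R_neg n m = fact m * fact n / fact (m + n + 1)"
proof -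
  obtain b where b: "bernoulli_recurrence b" and zeta: "\<And>N. zeta (- of_nat N) = - b (Suc N) / of_nat (Suc N)"
    using zeta_nonpos_int by blast
  interpret bernoulli_recurrence b by (rule b)
  define \<beta> :: complex where "\<beta> = fact m * fact n / fact (m + n + 1)"
  define d where "d = b (m + n + 1) / of_nat (m + n + 1)"
  have "R_neg m n = (-1) ^ n * \<beta> + d - bernoulli_beta m n"
    using R_neg_bernoulli_beta[OF b zeta, of m n] assms by (simp add: \<beta>_def d_def)
  moreover have "R_neg n m = (-1) ^ m * \<beta> + d - bernoulli_beta n m"
    using R_neg_bernoulli_beta[OF b zeta, of n m] assms by (simp add: \<beta>_def d_def add.commute mult.commute)
  moreover have "(-1) ^ n * bernoulli_beta m n + (-1) ^ m * bernoulli_beta n m = \<beta>"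
    using bernoulli_beta_reflection[of n m] assms(3) by (simp add: \<beta>_def)
  \<comment> \<open>The compensating term is symmetric in m and n, which have opposite
    parity.\<close>
  moreover have "(-1) ^ n * d + (-1) ^ m * d = 0"
    using assms(3) by (cases "even m") auto
  moreover have "(-1) ^ n * ((-1) ^ n * \<beta>) = \<beta>" "(-1) ^ m * ((-1) ^ m * \<beta>) = \<beta>"
    by (simp_all flip: mult.assoc power_mult_distrib)
  \<comment> \<open>The explicit terms contribute twice the Beta value, and the reflection formula
    removes one of them.\<close>
  ultimately have "(-1) ^ n * R_neg m n + (-1) ^ m * R_neg n m = \<beta>"
    by (simp add: distrib_left right_diff_distrib) (simp add: algebra_simps)
  then show ?thesis by (simp only: \<beta>_def)
qed

end
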